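(* The set $\mathcal{S}$ is infinite.
   Context: For an integer base $g\ge2$ and integer $m\ge0$, $s_g(m)$ denotes the sum of base-$g$ digits of $m$. A positive integer $m$ has a strict $s$-decomposition if $m=\prod_{\nu=1}^n g_\nu^{e_\nu}$ with exponents $e_\nu\ge1$ and proper factors $1<g_\nu<m$, strictly increasing $g_1<\dots<g_n$ (not necessarily coprime), with $s_{g_\nu}(m)=g_\nu$ for each $\nu$; $\mathcal{S}$ is the set of positive integers having a strict $s$-decomposition. *)

theory Defs
  imports Complex_Main
begin

(* The guard g < 2 only makes the recursion terminate; bases g < 2 are never used below. *)
function digit_sum :: "nat \<Rightarrow> nat \<Rightarrow> nat" where
  "digit_sum g m = (if g < 2 \<or> m = 0 then 0 else m mod g + digit_sum g (m div g))"
  by auto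
termination by (relation "measure snd") auto

declare digit_sum.simps [simp del]

lemma digit_sum_expansion:
  assumes "g \<ge> 2" "\<And>i. i < k \<Longrightarrow> d i < g"
  shows "digit_sum g (\<Sum>i<k. d i * g ^ i) = (\<Sum>i<k. d i)"
  using assms(2)
proof (induction k arbitrary: d)
  case 0
  then show ?case by (simp add: digit_sum.simps)
next
  case (Suc k)
  define M where "M = (\<Sum>i<k. d (Suc i) * g ^ i)"
  have IH: "digit_sum g M = (\<Sum>i<k. d (Suc i))"
    unfolding M_def using Suc.prems by (intro Suc.IH) auto
  have eq: "(\<Sum>i<Suc k. d i * g ^ i) = d 0 + M * g"
    unfolding M_def sum.lessThan_Suc_shift sum_distrib_right by (simp add: ac_simps)
  have "d 0 < g" using Suc.prems by simp
  then have "(d 0 + M * g) mod g = d 0" "(d 0 + M * g) div g = M"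
    using assms(1) by simp_all
  moreover have "digit_sum g 0 = 0" by (simp add: digit_sum.simps)
  ultimately have "digit_sum g (d 0 + M * g) = d 0 + digit_sum g M"
    using assms(1) by (subst digit_sum.simps) auto
  then show ?case unfolding eq IH by (simp only: sum.lessThan_Suc_shift)
qed

(* The condition n >= 1 excludes the empty product, i.e. m = 1. *)
definition strict_s_decomposition ::
    "nat \<Rightarrow> nat \<Rightarrow> (nat \<Rightarrow> nat) \<Rightarrow> (nat \<Rightarrow> nat) \<Rightarrow> bool" where
  "strict_s_decomposition m n g e \<longleftrightarrow>
     n \<ge> 1 \<and>
     m = (\<Prod>\<nu>=1..n. g \<nu> ^ e \<nu>) \<and>
     strict_mono_on {1..n} g \<and>
     (\<forall>\<nu>\<in>{1..n}. e \<nu> \<ge> 1 \<and> 1 < g \<nu> \<and> g \<nu> < m \<and> digit_sum (g \<nu>) m = g \<nu>)"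

definition \<S> :: "nat set" where
  "\<S> = {m. m > 0 \<and> (\<exists>n g e. strict_s_decomposition m n g e)}"

end

theory Submission
  imports Defs "HOL-Library.Infinite_Set"
begin

text \<open>
  For every \<open>k \<ge> 1\<close> the number \<open>m = a\<^sup>2 b\<close> with \<open>a = 2k + 1\<close>, \<open>b = 4k + 1\<close> works:
  \<open>b = 1 \<cdot> a + 2k\<close> gives \<open>s\<^sub>a(m) = s\<^sub>a(b) = a\<close>, and
  \<open>a\<^sup>2 = k \<cdot> b + (3k + 1)\<close> gives \<open>s\<^sub>b(m) = s\<^sub>b(a\<^sup>2) = b\<close>.
\<close>

lemma digit_sum_0 [simp]: "digit_sum g 0 = 0"
  by (simp add: digit_sum.simps)

lemma digit_sum_add_mult:
  assumes "g \<ge> 2" "d < g"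
  shows "digit_sum g (d + g * q) = d + digit_sum g q"
  using assms by (cases "d + g * q = 0") (simp_all add: digit_sum.simps[of g "d + g * q"])

text \<open>Multiplying by the base only appends a zero digit, so a factor equal to the base can be
  stripped from \<open>m\<close>.\<close>

lemma digit_sum_mult:
  assumes "g \<ge> 2"
  shows "digit_sum g (g * q) = digit_sum g q"
  using digit_sum_add_mult[of g 0 q] assms by simp

lemma digit_sum_two_digits:
  assumes "g \<ge> 2" "d < g" "c < g"
  shows "digit_sum g (d + g * c) = d + c"
  using digit_sum_add_mult[of g c 0] assms by (simp add: digit_sum_add_mult)

lemma square_mult_mem_S:
  fixes k :: nat
  assumes "k \<ge> 1"
  shows "(2 * k + 1)\<^sup>2 * (4 * k + 1) \<in> \<S>"
proof -
  define a b where "a = 2 * k + 1" and "b = 4 * k + 1"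
  define m where "m = a\<^sup>2 * b"
  define g where "g = (\<lambda>\<nu>::nat. if \<nu> = 1 then a else b)"
  define e where "e = (\<lambda>\<nu>::nat. if \<nu> = 1 then 2 else 1::nat)"
  have ab: "2 \<le> a" "a < b" "2 \<le> b"
    using assms by (auto simp: a_def b_def)
  \<comment> \<open>Written as \<open>a * (a * b)\<close>, \<open>m\<close> loses two trailing zeros
    in base \<open>a\<close>.\<close>
  have "digit_sum a m = digit_sum a b"
    using ab by (simp add: m_def power2_eq_square mult.assoc digit_sum_mult)
  also have "b = 2 * k + a * 1"
    by (simp add: a_def b_def)
  also have "digit_sum a \<dots> = a"
    using ab by (subst digit_sum_two_digits) (auto simp: a_def)
  finally have dsa: "digit_sum a m = a" .
  have "digit_sum b m = digit_sum b (a\<^sup>2)"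
    using ab by (simp add: m_def mult.commute[of _ b] digit_sum_mult)
  also have "a\<^sup>2 = (3 * k + 1) + b * k"
    by (simp add: a_def b_def power2_eq_square algebra_simps)
  \<comment> \<open>\<open>3 * k + 1\<close> is a valid digit in base \<open>4 * k + 1\<close>
    because \<open>k \<ge> 1\<close>.\<close>
  also have "digit_sum b \<dots> = b"
    using assms ab by (subst digit_sum_two_digits) (auto simp: b_def)
  finally have dsb: "digit_sum b m = b" .
  \<comment> \<open>Since \<open>a < b\<close>, the bound \<open>b < m\<close> makes both factors
    proper.\<close>
  have "1 < a\<^sup>2"
    using ab by (intro one_less_power) auto
  then have bm: "b < m"
    using ab by (simp add: m_def)
  have "m = (\<Prod>\<nu>=1..2. g \<nu> ^ e \<nu>)"
    by (simp add: m_def g_def e_def numeral_2_eq_2)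
  moreover have "strict_mono_on {1..2} g"
    using ab by (auto simp: strict_mono_on_def g_def)
  ultimately have "strict_s_decomposition m 2 g e"
    using ab bm dsa dsb unfolding strict_s_decomposition_def
    by (auto simp: g_def e_def)
  with bm show ?thesis
    unfolding \<S>_def m_def a_def b_def by auto
qed

theorem theorem2p5:
  shows "infinite \<S>"
  unfolding infinite_nat_iff_unbounded
proof
  fix k :: nat
  \<comment> \<open>The parameter \<open>Suc k\<close> is at least 1 and already gives an element
    above \<open>k\<close>.\<close>
  have "k < (2 * Suc k + 1)\<^sup>2 * (4 * Suc k + 1)"
    by (simp add: power2_eq_square algebra_simps)
  then show "\<exists>m>k. m \<in> \<S>"
    using square_mult_mem_S[of "Suc k"] by auto
qed

end
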